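(* For every integer $n\ge 3$, $\gamma_{oiR}(P_{n}\Box C_{3})=\lceil \frac{7n}{3}\rceil$.
   Context: All graphs are simple and undirected. $P_n$ denotes the path on $n$ vertices and $C_m$ the cycle on $m$ vertices; $P_n\Box C_m$ is their Cartesian product, with vertex set $\{v_{i,j}: 0\le i\le n-1,\ 0\le j\le m-1\}$, where $v_{i,j}$ and $v_{i',j'}$ are adjacent iff either $i=i'$ and $j'\equiv j\pm1 \pmod m$, or $j=j'$ and $|i-i'|=1$. For a graph $G=(V,E)$, an outer independent Roman dominating function (OIRDF) is a function $f:V\to\{0,1,2\}$ such that every vertex $u$ with $f(u)=0$ has a neighbour $v$ with $f(v)=2$, and the set $V_0=\{u\in V: f(u)=0\}$ is an independent set. The weight of $f$ is $w(f)=\sum_{v\in V}f(v)$, and $\gamma_{oiR}(G)$ is the minimum weight of an OIRDF of $G$. *)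

theory Defs
  imports Complex_Main
begin

text \<open>An undirected graph is a pair of a vertex set and a set of edges, each edge being a
  set of two distinct vertices.\<close>

type_synonym 'a ugraph = "'a set \<times> 'a set set"

abbreviation verts :: "'a ugraph \<Rightarrow> 'a set" where
  "verts G \<equiv> fst G"

abbreviation edges :: "'a ugraph \<Rightarrow> 'a set set" where
  "edges G \<equiv> snd G"

definition simple_graph :: "'a ugraph \<Rightarrow> bool" where
  "simple_graph G \<longleftrightarrow> (\<forall>e\<in>edges G. e \<subseteq> verts G \<and> card e = 2)"

definition adjacent :: "'a ugraph \<Rightarrow> 'a \<Rightarrow> 'a \<Rightarrow> bool" where
  "adjacent G u v \<longleftrightarrow> {u, v} \<in> edges G"

definition independent_set :: "'a ugraph \<Rightarrow> 'a set \<Rightarrow> bool" where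
  "independent_set G S \<longleftrightarrow> S \<subseteq> verts G \<and> (\<forall>u\<in>S. \<forall>v\<in>S. \<not> adjacent G u v)"

definition path_graph :: "nat \<Rightarrow> nat ugraph" where
  "path_graph n = ({..<n}, {{i, Suc i} | i. Suc i < n})"

text \<open>This is a cycle for \<open>m \<ge> 3\<close>; for smaller \<open>m\<close> it is degenerate.\<close>

definition cycle_graph :: "nat \<Rightarrow> nat ugraph" where
  "cycle_graph m = ({..<m}, {{j, Suc j mod m} | j. j < m})"

definition cartesian_product :: "'a ugraph \<Rightarrow> 'b ugraph \<Rightarrow> ('a \<times> 'b) ugraph"
    (infixl \<open>\<box>\<close> 70) where
  "G \<box> H = (verts G \<times> verts H,
     {{(u, x), (u, y)} | u x y. u \<in> verts G \<and> adjacent H x y} \<union>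
     {{(u, x), (v, x)} | u v x. x \<in> verts H \<and> adjacent G u v})"

text \<open>Functions are total in HOL; only the values of \<open>f\<close> on the vertices matter.\<close>

definition OIRDF :: "'a ugraph \<Rightarrow> ('a \<Rightarrow> nat) \<Rightarrow> bool" where
  "OIRDF G f \<longleftrightarrow>
     (\<forall>v\<in>verts G. f v \<in> {0, 1, 2}) \<and>
     (\<forall>u\<in>verts G. f u = 0 \<longrightarrow> (\<exists>v\<in>verts G. adjacent G u v \<and> f v = 2)) \<and>
     independent_set G {u \<in> verts G. f u = 0}"

definition weight :: "'a ugraph \<Rightarrow> ('a \<Rightarrow> nat) \<Rightarrow> nat" where
  "weight G f = (\<Sum>v\<in>verts G. f v)"

definition gamma_oiR :: "'a ugraph \<Rightarrow> nat" where
  "gamma_oiR G = (LEAST w. \<exists>f. OIRDF G f \<and> weight G f = w)"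


lemma OIRDF_const_1: "OIRDF G (\<lambda>_. 1)"
  by (simp add: OIRDF_def independent_set_def)

lemma gamma_oiR_attained: "\<exists>f. OIRDF G f \<and> weight G f = gamma_oiR G"
  unfolding gamma_oiR_def by (rule LeastI_ex) (use OIRDF_const_1 in blast)

lemma gamma_oiR_le: "OIRDF G f \<Longrightarrow> gamma_oiR G \<le> weight G f"
  unfolding gamma_oiR_def by (rule Least_le) blast

lemma adjacent_path_graph:
  "adjacent (path_graph n) i i' \<longleftrightarrow> i < n \<and> i' < n \<and> (i' = Suc i \<or> i = Suc i')"
  by (auto simp: adjacent_def path_graph_def doubleton_eq_iff)

lemma adjacent_cycle_graph:
  "adjacent (cycle_graph m) j j' \<longleftrightarrow>
     j < m \<and> j' < m \<and> (j' = Suc j mod m \<or> j = Suc j' mod m)"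
  by (auto simp: adjacent_def cycle_graph_def doubleton_eq_iff)

lemma adjacent_commute: "adjacent G u v \<longleftrightarrow> adjacent G v u"
  by (simp add: adjacent_def insert_commute)

lemma verts_cartesian_product [simp]: "verts (G \<box> H) = verts G \<times> verts H"
  by (simp add: cartesian_product_def)

lemma adjacent_cartesian_product:
  "adjacent (G \<box> H) (u, x) (v, y) \<longleftrightarrow>
     (u = v \<and> u \<in> verts G \<and> adjacent H x y) \<or> (x = y \<and> x \<in> verts H \<and> adjacent G u v)"
proof -
  have "adjacent (G \<box> H) (u, x) (v, y) \<longleftrightarrow>
      (\<exists>a b c. {(u, x), (v, y)} = {(a, b), (a, c)} \<and> a \<in> verts G \<and> adjacent H b c) \<or>
      (\<exists>a b c. {(u, x), (v, y)} = {(a, c), (b, c)} \<and> c \<in> verts H \<and> adjacent G a b)"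
    unfolding adjacent_def [of "G \<box> H"] unfolding cartesian_product_def by simp
  moreover have "(\<exists>a b c. {(u, x), (v, y)} = {(a, b), (a, c)} \<and> a \<in> verts G \<and> adjacent H b c)
      \<longleftrightarrow> u = v \<and> u \<in> verts G \<and> adjacent H x y"
    using adjacent_commute [of H x y] by (auto simp: doubleton_eq_iff)
  moreover have "(\<exists>a b c. {(u, x), (v, y)} = {(a, c), (b, c)} \<and> c \<in> verts H \<and> adjacent G a b)
      \<longleftrightarrow> x = y \<and> x \<in> verts H \<and> adjacent G u v"
    using adjacent_commute [of G u v] by (auto simp: doubleton_eq_iff)
  ultimately show ?thesis by simp
qed

lemma adjacent_path_cycle:
  "adjacent (path_graph n \<box> cycle_graph m) (i, j) (i', j') \<longleftrightarrow>
     i < n \<and> i' < n \<and> j < m \<and> j' < m \<and>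
     ((i = i' \<and> (j' = Suc j mod m \<or> j = Suc j' mod m)) \<or>
      (j = j' \<and> (i' = Suc i \<or> i = Suc i')))"
  unfolding adjacent_cartesian_product adjacent_path_graph adjacent_cycle_graph
  by (auto simp: path_graph_def cycle_graph_def)

lemma simple_path_graph: "simple_graph (path_graph n)"
  by (auto simp: simple_graph_def path_graph_def)

lemma simple_cycle_graph:
  assumes "m \<ge> 2"
  shows "simple_graph (cycle_graph m)"
proof -
  have "j \<noteq> Suc j mod m" if "j < m" for j
    using assms that by (cases "Suc j = m") auto
  then show ?thesis
    using assms by (auto simp: simple_graph_def cycle_graph_def card_2_iff doubleton_eq_iff)
qed

lemma simple_cartesian_product:
  assumes "simple_graph G" "simple_graph H"
  shows "simple_graph (G \<box> H)"
proof -
  have G: "u \<in> verts G \<and> v \<in> verts G \<and> u \<noteq> v" if "adjacent G u v" for u v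
    using assms(1) that by (fastforce simp: simple_graph_def adjacent_def card_2_iff)
  have H: "x \<in> verts H \<and> y \<in> verts H \<and> x \<noteq> y" if "adjacent H x y" for x y
    using assms(2) that by (fastforce simp: simple_graph_def adjacent_def card_2_iff)
  show ?thesis
    unfolding simple_graph_def by (auto simp: cartesian_product_def dest: G H)
qed

end

theory Submission
  imports Defs
begin

text \<open>At most one vertex of each triangle \<open>{i} \<times> C\<^sub>3\<close> has value 0, so each triangle has weight at
  least 2, and weight exactly 2 forces the values 0, 1, 1. The vertex of value 0 then needs a
  neighbour of value 2 in an adjacent triangle, which has weight at least 3. Hence every triangle is
  within distance one of a heavy one, so at least \<open>n/3\<close> triangles are heavy and the weight is at
  least \<open>2n + n/3\<close>. Equality is reached by repeating columns of weights 2, 3, 2.\<close>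

definition column_weight :: "(nat \<times> nat \<Rightarrow> nat) \<Rightarrow> nat \<Rightarrow> nat" where
  "column_weight f i = f (i, 0) + f (i, 1) + f (i, 2)"

lemma lessThan_3: "{..<3::nat} = {0, 1, 2}"
  by auto

lemma verts_path_cycle: "verts (path_graph n \<box> cycle_graph m) = {..<n} \<times> {..<m}"
  by (simp add: path_graph_def cycle_graph_def)

lemma weight_path_cycle3:
  "weight (path_graph n \<box> cycle_graph 3) f = (\<Sum>i<n. column_weight f i)"
  unfolding weight_def verts_path_cycle
  by (simp add: sum.cartesian_product' column_weight_def lessThan_3 add.assoc)

text \<open>Any two distinct vertices of \<open>C_3\<close> are adjacent, so the condition modulo 3
  collapses to \<open>j \<noteq> j'\<close>.\<close>

lemma adjacent_path_cycle3:
  "adjacent (path_graph n \<box> cycle_graph 3) (i, j) (i', j') \<longleftrightarrow>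
     i < n \<and> i' < n \<and> j < 3 \<and> j' < 3 \<and>
     ((i = i' \<and> j \<noteq> j') \<or> (j = j' \<and> (i' = Suc i \<or> i = Suc i')))"
proof (cases "j < 3 \<and> j' < 3")
  case True
  then have "(j' = Suc j mod 3 \<or> j = Suc j' mod 3) \<longleftrightarrow> j \<noteq> j'"
    by (auto simp: mod_Suc)
  then show ?thesis
    unfolding adjacent_path_cycle by (simp only:)
qed (auto simp only: adjacent_path_cycle)

text \<open>Turns the graph conditions into index conditions. Independence splits into one condition
  inside a triangle and one between consecutive triangles; by symmetry the latter only has to look
  from \<open>i\<close> to \<open>Suc i\<close>.\<close>

lemma OIRDF_path_cycle3_iff:
  "OIRDF (path_graph n \<box> cycle_graph 3) f \<longleftrightarrow>
     (\<forall>i<n. \<forall>j<3. f (i, j) \<le> 2) \<and>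
     (\<forall>i<n. \<forall>j<3. f (i, j) = 0 \<longrightarrow>
        (\<exists>j'<3. j' \<noteq> j \<and> f (i, j') = 2) \<or>
        (\<exists>i'<n. (i' = Suc i \<or> i = Suc i') \<and> f (i', j) = 2)) \<and>
     (\<forall>i<n. \<forall>j<3. \<forall>j'<3. f (i, j) = 0 \<longrightarrow> f (i, j') = 0 \<longrightarrow> j = j') \<and>
     (\<forall>i. Suc i < n \<longrightarrow> (\<forall>j<3. f (i, j) = 0 \<longrightarrow> f (Suc i, j) \<noteq> 0))"
  (is "?L \<longleftrightarrow> ?A \<and> ?B \<and> ?C \<and> ?D")
proof -
  let ?G = "path_graph n \<box> cycle_graph 3"
  have val: "x \<in> {0, 1, 2} \<longleftrightarrow> x \<le> 2" for x :: nat
    by auto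
  have "(\<forall>v\<in>verts ?G. f v \<in> {0, 1, 2}) \<longleftrightarrow> ?A"
    unfolding verts_path_cycle val by auto
  moreover have "(\<forall>u\<in>verts ?G. f u = 0 \<longrightarrow> (\<exists>v\<in>verts ?G. adjacent ?G u v \<and> f v = 2)) \<longleftrightarrow> ?B"
    unfolding verts_path_cycle by (simp add: adjacent_path_cycle3 Bex_def Ball_def) blast
  moreover have "independent_set ?G {u \<in> verts ?G. f u = 0} \<longleftrightarrow> ?C \<and> ?D"
  proof -
    have "independent_set ?G {u \<in> verts ?G. f u = 0} \<longleftrightarrow>
        (\<forall>i j i' j'. f (i, j) = 0 \<longrightarrow> f (i', j') = 0 \<longrightarrow> \<not> adjacent ?G (i, j) (i', j'))"
      unfolding independent_set_def verts_path_cycle by (auto simp: adjacent_path_cycle3)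
    also have "\<dots> \<longleftrightarrow> ?C \<and> ?D" (is "?I \<longleftrightarrow> _")
    proof
      assume I: ?I
      have ?C
        using I unfolding adjacent_path_cycle3 by metis
      moreover have ?D
        using I unfolding adjacent_path_cycle3 by (metis Suc_lessD)
      ultimately show "?C \<and> ?D" ..
    next
      assume "?C \<and> ?D"
      then have C: ?C and D: ?D by blast+
      show ?I
        unfolding adjacent_path_cycle3 using C D by metis
    qed
    finally show ?thesis .
  qed
  ultimately show ?thesis
    unfolding OIRDF_def by blast
qed

lemma column_at_most_one_zero:
  assumes "OIRDF (path_graph n \<box> cycle_graph 3) f" "i < n"
  shows "f (i, 0) \<noteq> 0 \<or> f (i, 1) \<noteq> 0" "f (i, 0) \<noteq> 0 \<or> f (i, 2) \<noteq> 0"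
    "f (i, 1) \<noteq> 0 \<or> f (i, 2) \<noteq> 0"
proof -
  have one_zero: "\<forall>j<3. \<forall>j'<3. f (i, j) = 0 \<longrightarrow> f (i, j') = 0 \<longrightarrow> j = j'"
    using assms unfolding OIRDF_path_cycle3_iff by blast
  show "f (i, 0) \<noteq> 0 \<or> f (i, 1) \<noteq> 0" "f (i, 0) \<noteq> 0 \<or> f (i, 2) \<noteq> 0"
    "f (i, 1) \<noteq> 0 \<or> f (i, 2) \<noteq> 0"
    using one_zero [rule_format, of 0 1] one_zero [rule_format, of 0 2]
      one_zero [rule_format, of 1 2] by auto
qed

lemma column_weight_ge_2:
  assumes "OIRDF (path_graph n \<box> cycle_graph 3) f" "i < n"
  shows "column_weight f i \<ge> 2"
  using column_at_most_one_zero [OF assms] unfolding column_weight_def by linarith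

text \<open>Besides the 2, two entries remain, and they cannot both be 0.\<close>

lemma column_weight_ge_3:
  assumes "OIRDF (path_graph n \<box> cycle_graph 3) f" "i < n" "j < 3" "f (i, j) = 2"
  shows "column_weight f i \<ge> 3"
proof -
  have "j = 0 \<or> j = 1 \<or> j = 2"
    using assms(3) by linarith
  then have "f (i, 0) = 2 \<or> f (i, 1) = 2 \<or> f (i, 2) = 2"
    using assms(4) by blast
  then show ?thesis
    using column_at_most_one_zero [OF assms(1,2)] unfolding column_weight_def by linarith
qed

lemma heavy_column_nearby:
  assumes f: "OIRDF (path_graph n \<box> cycle_graph 3) f" and i: "i < n"
  shows "\<exists>h<n. column_weight f h \<ge> 3 \<and> (i = h \<or> i = Suc h \<or> h = Suc i)"
proof (cases "column_weight f i \<ge> 3")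
  case False
  then have "f (i, 0) = 0 \<or> f (i, 1) = 0 \<or> f (i, 2) = 0"
    unfolding column_weight_def by linarith
  moreover have "0 < (3::nat)" "1 < (3::nat)" "2 < (3::nat)"
    by simp_all
  ultimately obtain j where j: "j < 3" "f (i, j) = 0"
    by metis
  \<comment> \<open>A 2 in column \<open>i\<close> would make it heavy, so the 2 that dominates
    \<open>(i, j)\<close> lies in row \<open>j\<close> of a neighbouring column.\<close>
  have "\<not> (\<exists>j'<3. f (i, j') = 2)"
    using column_weight_ge_3 [OF f i] False by blast
  then obtain i' where "i' < n" "i' = Suc i \<or> i = Suc i'" "f (i', j) = 2"
    using f i j unfolding OIRDF_path_cycle3_iff by blast
  then show ?thesis
    using column_weight_ge_3 [OF f] j(1) by blast
qed (use i in blast)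

lemma OIRDF_weight_ge:
  assumes f: "OIRDF (path_graph n \<box> cycle_graph 3) f"
  shows "7 * n \<le> 3 * weight (path_graph n \<box> cycle_graph 3) f"
proof -
  define H where "H = {h. h < n \<and> column_weight f h \<ge> 3}"
  have finH: "finite H" and H: "H \<subseteq> {..<n}"
    by (auto simp: H_def)
  \<comment> \<open>For \<open>h = 0\<close> truncated subtraction gives \<open>h - 1 = 0\<close>,
    and \<open>Suc h\<close> may equal \<open>n\<close>. Both are harmless: all that counts is a
    cover by sets of at most 3 elements.\<close>
  have "{..<n} \<subseteq> (\<Union>h\<in>H. {h - 1, h, Suc h})"
  proof
    fix i assume "i \<in> {..<n}"
    then obtain h where "h \<in> H" "i = h \<or> i = Suc h \<or> h = Suc i"
      using heavy_column_nearby [OF f] by (auto simp: H_def)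
    then show "i \<in> (\<Union>h\<in>H. {h - 1, h, Suc h})"
      by (intro UN_I [of h]) auto
  qed
  then have "n \<le> card (\<Union>h\<in>H. {h - 1, h, Suc h})"
    using card_mono [of "\<Union>h\<in>H. {h - 1, h, Suc h}" "{..<n}"] finH by simp
  also have "\<dots> \<le> (\<Sum>h\<in>H. card {h - 1, h, Suc h})"
    by (rule card_UN_le [OF finH])
  also have "\<dots> \<le> (\<Sum>h\<in>H. 3)"
    by (intro sum_mono) (simp add: card_insert_if)
  finally have "n \<le> 3 * card H"
    by simp
  moreover have "2 * n + card H \<le> (\<Sum>i<n. column_weight f i)"
  proof -
    \<comment> \<open>Charge 2 to every column and 1 more to each heavy one, then compare column by
      column.\<close>
    have "2 * n + card H = (\<Sum>i<n. 2 + (if i \<in> H then 1 else 0))"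
      using H unfolding sum.distrib by (simp add: sum.If_cases Int_absorb1)
    also have "\<dots> \<le> (\<Sum>i<n. column_weight f i)"
      using column_weight_ge_2 [OF f] by (intro sum_mono) (auto simp: H_def numeral_2_eq_2)
    finally show ?thesis .
  qed
  ultimately show ?thesis
    unfolding weight_path_cycle3 by linarith
qed

text \<open>Writing \<open>p\<close> for the parity of the block \<open>i div 3\<close>, the outer columns of a block have a single
  0, in row \<open>p\<close>, and the middle column has a 2 in row \<open>p\<close> and a 0 in row 2. Alternating \<open>p\<close>
  separates the zeros of consecutive blocks. An incomplete block consisting of one column gets
  the values 1, 1, 1.\<close>

definition block_labelling :: "nat \<Rightarrow> nat \<times> nat \<Rightarrow> nat" where
  "block_labelling n = (\<lambda>(i, j).
     if i mod 3 = 1 then (if j = i div 3 mod 2 then 2 else if j = 2 then 0 else 1)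
     else if j = i div 3 mod 2 \<and> \<not> (i mod 3 = 0 \<and> Suc i = n) then 0 else 1)"

text \<open>A 0 in an outer column is dominated by the 2 in the middle column of its block, and the
  0 of a middle column by the 2 in that same column.\<close>

lemma OIRDF_block_labelling: "OIRDF (path_graph n \<box> cycle_graph 3) (block_labelling n)"
  unfolding OIRDF_path_cycle3_iff
proof (intro conjI allI impI)
  fix i j
  assume ij: "i < n" "j < 3" and zero: "block_labelling n (i, j) = 0"
  consider (first) "i mod 3 = 0" | (middle) "i mod 3 = 1" | (last) "i mod 3 = 2"
    by linarith
  then show "(\<exists>j'<3. j' \<noteq> j \<and> block_labelling n (i, j') = 2) \<or>
      (\<exists>i'<n. (i' = Suc i \<or> i = Suc i') \<and> block_labelling n (i', j) = 2)"
  proof cases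
    case first
    \<comment> \<open>A first column that is also the last of the graph has no 0, so the middle
      column to its right exists here.\<close>
    then have "j = i div 3 mod 2" "Suc i \<noteq> n"
      using zero by (auto simp: block_labelling_def split: if_splits)
    moreover have "Suc i mod 3 = 1" "Suc i div 3 = i div 3"
      using first by presburger+
    ultimately have "block_labelling n (Suc i, j) = 2" "Suc i < n"
      using ij by (auto simp: block_labelling_def)
    then show ?thesis by blast
  next
    case middle
    define p where "p = i div 3 mod 2"
    have "p < 3"
      unfolding p_def by (rule less_trans [of _ 2]) auto
    moreover have "p \<noteq> j" "block_labelling n (i, p) = 2"
      using middle zero by (auto simp: block_labelling_def p_def)
    ultimately show ?thesis by blast
  next
    case last
    then obtain k where k: "i = Suc k"
      by (cases i) auto
    have "j = i div 3 mod 2"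
      using last zero by (auto simp: block_labelling_def split: if_splits)
    moreover have "k mod 3 = 1" "k div 3 = i div 3"
      using last unfolding k by presburger+
    ultimately have "block_labelling n (k, j) = 2" "k < n"
      using ij k by (auto simp: block_labelling_def)
    then show ?thesis
      using k by blast
  qed
next
  fix i j j'
  assume "j < 3" "j' < 3" "block_labelling n (i, j) = 0" "block_labelling n (i, j') = 0"
  then show "j = j'"
    by (auto simp: block_labelling_def split: if_splits)
next
  fix i j
  assume zero: "block_labelling n (i, j) = 0"
  \<comment> \<open>Row 2 never equals a parity row, which separates a middle 0 from the next
    column; consecutive blocks use different parity rows.\<close>
  have parity: "2 \<noteq> k mod 2" "k mod 2 \<noteq> Suc k mod 2" for k :: nat
    by presburger+
  consider "i mod 3 = 0" "Suc i mod 3 = 1" "Suc i div 3 = i div 3"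
    | "i mod 3 = 1" "Suc i mod 3 = 2"
    | "i mod 3 = 2" "Suc i mod 3 = 0" "Suc i div 3 = Suc (i div 3)"
    by (simp add: mod_Suc div_Suc) linarith
  then show "block_labelling n (Suc i, j) \<noteq> 0"
  proof cases
    case 1
    then show ?thesis
      using zero by (simp add: block_labelling_def split: if_splits)
  next
    case 2
    then have "j = 2"
      using zero by (simp add: block_labelling_def split: if_splits)
    then show ?thesis
      using 2 parity(1) by (simp add: block_labelling_def)
  next
    case 3
    then have "j = i div 3 mod 2"
      using zero by (simp add: block_labelling_def split: if_splits)
    then show ?thesis
      using 3 parity(2) by (simp add: block_labelling_def)
  qed
qed (auto simp: block_labelling_def)

lemma column_weight_block_labelling:
  "column_weight (block_labelling n) i =
     (if i mod 3 = 1 \<or> (i mod 3 = 0 \<and> Suc i = n) then 3 else 2)"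
proof -
  have "i div 3 mod 2 = 0 \<or> i div 3 mod 2 = 1"
    by linarith
  then show ?thesis
    by (auto simp: column_weight_def block_labelling_def)
qed

text \<open>Every block, complete or not, has exactly one column of weight 3, and
  \<open>(n + 2) div 3\<close>, the ceiling of \<open>n / 3\<close>, counts the blocks.\<close>

lemma weight_block_labelling:
  "weight (path_graph n \<box> cycle_graph 3) (block_labelling n) = 2 * n + (n + 2) div 3"
proof (cases n)
  \<comment> \<open>Only the last column \<open>m\<close> can depend on \<open>n\<close>, so it is
    summed separately.\<close>
  case (Suc m)
  \<comment> \<open>\<open>(k + 1) div 3\<close> counts the \<open>i < k\<close> with
    \<open>i mod 3 = 1\<close>.\<close>
  have middle: "(\<Sum>i<k. if i mod 3 = 1 then 3 else 2) = 2 * k + (k + 1) div 3" for k :: nat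
    by (induction k) (simp, simp, presburger)
  have "(\<Sum>i<m. column_weight (block_labelling n) i) = (\<Sum>i<m. if i mod 3 = 1 then 3 else 2)"
    by (rule sum.cong) (auto simp: column_weight_block_labelling Suc)
  then have "(\<Sum>i<n. column_weight (block_labelling n) i) =
      2 * m + (m + 1) div 3 + (if m mod 3 = 1 \<or> m mod 3 = 0 then 3 else 2)"
    unfolding middle by (simp add: Suc column_weight_block_labelling)
  also have "\<dots> = 2 * n + (n + 2) div 3"
    unfolding Suc by presburger
  finally show ?thesis
    unfolding weight_path_cycle3 .
qed (simp add: weight_path_cycle3)

theorem theorem4:
  fixes n :: nat
  assumes "n \<ge> 3"
  shows "int (gamma_oiR (path_graph n \<box> cycle_graph 3)) = \<lceil>7 * real n / 3\<rceil>"
proof -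
  let ?g = "gamma_oiR (path_graph n \<box> cycle_graph 3)"
  have "7 * n \<le> 3 * ?g"
    using gamma_oiR_attained OIRDF_weight_ge by metis
  moreover have "?g \<le> 2 * n + (n + 2) div 3"
    using gamma_oiR_le [OF OIRDF_block_labelling] weight_block_labelling by metis
  then have "3 * ?g \<le> 7 * n + 2"
    by linarith
  \<comment> \<open>Only one multiple of 3 lies between \<open>7 * n\<close> and
    \<open>7 * n + 2\<close>, which fixes \<open>?g\<close> as the ceiling.\<close>
  ultimately show ?thesis
    by linarith
qed

end
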